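(* Let $n\ge 2$, let $P=(p_{lm})$ be an $n\times n$ row substochastic matrix of spectral radius less than $1$, and let $I$ be the $n\times n$ identity matrix. Then for every $m\in\{1,\dots,n\}$, $$\frac{p_{m\cdot}\bigl((I-P)(m|m)\bigr)^{-1}p_{\cdot m}}{1-p_{mm}-p_{m\cdot}\bigl((I-P)(m|m)\bigr)^{-1}p_{\cdot m}}=\sum_{k\neq m}\frac{p_{km}\,f_{mk}\bigl((I-P)(k|k)\bigr)^{-1}p_{\cdot k}}{1-p_{kk}-p_{k\cdot}\bigl((I-P)(k|k)\bigr)^{-1}p_{\cdot k}},$$ and for all $l,m\in\{1,\dots,n\}$ with $l\neq m$, $$\frac{(1-p_{mm})\,f_{lm}\bigl((I-P)(m|m)\bigr)^{-1}p_{\cdot m}}{1-p_{mm}-p_{m\cdot}\bigl((I-P)(m|m)\bigr)^{-1}p_{\cdot m}}=\frac{p_{lm}}{1-p_{ll}-p_{l\cdot}\bigl((I-P)(l|l)\bigr)^{-1}p_{\cdot l}}+\sum_{\substack{k\neq l,\\ k\neq m}}\frac{p_{km}\,f_{lk}\bigl((I-P)(k|k)\bigr)^{-1}p_{\cdot k}}{1-p_{kk}-p_{k\cdot}\bigl((I-P)(k|k)\bigr)^{-1}p_{\cdot k}}.$$ All sums are over $k\in\{1,\dots,n\}$ subject to the indicated restrictions.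
   Context: A real $n\times n$ matrix $P=(p_{lm})$ is called row substochastic if all $p_{lm}\ge 0$ and $\sum_{m=1}^n p_{lm}\le 1$ for every $l$. For a square matrix $B$, $B(i|j)$ denotes the matrix obtained from $B$ by deleting the $i$th row and the $j$th column. $p_{\cdot l}$ denotes the $l$th column of $P$ with its $l$th entry deleted (a column vector of length $n-1$), and $p_{l\cdot}$ denotes the $l$th row of $P$ with its $l$th entry deleted (a row vector of length $n-1$). Let $e_i$ be the $i$th element of the standard basis of $\mathbb{R}^{n-1}$ (a column vector). For $m\neq l$ in $\{1,\dots,n\}$, $f_{ml}$ is the row vector of length $n-1$ given by $f_{ml}=e_m^T$ if $m<l$ and $f_{ml}=e_{m-1}^T$ if $m>l$. *)

theory Defs
  imports
    "Jordan_Normal_Form.Gauss_Jordan_Elimination"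
    "Jordan_Normal_Form.Determinant"
    "Jordan_Normal_Form.Spectral_Radius"
begin

text \<open>
  Rows and columns are numbered from \<open>0\<close>, as is usual for \<^typ>\<open>'a mat\<close>; index
  \<open>i < n\<close> stands for the mathematical index \<open>i + 1\<close>. Row vectors and column vectors
  both have type \<^typ>\<open>real vec\<close>; a product \<open>row * matrix * column\<close> is rendered as
  \<open>row \<bullet> (matrix *\<^sub>v column)\<close>.
\<close>

definition row_substochastic :: "real mat \<Rightarrow> bool" where
  "row_substochastic P \<longleftrightarrow> square_mat P \<and>
     (\<forall>l<dim_row P. \<forall>m<dim_col P. 0 \<le> P $$ (l, m)) \<and>
     (\<forall>l<dim_row P. (\<Sum>m<dim_col P. P $$ (l, m)) \<le> 1)"

definition vec_del :: "'a vec \<Rightarrow> nat \<Rightarrow> 'a vec" where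
  "vec_del v l = vec (dim_vec v - 1) (\<lambda>i. v $ (if i < l then i else Suc i))"

definition col_del :: "'a mat \<Rightarrow> nat \<Rightarrow> 'a vec" where
  "col_del P l = vec_del (col P l) l"

definition row_del :: "'a mat \<Rightarrow> nat \<Rightarrow> 'a vec" where
  "row_del P l = vec_del (row P l) l"

text \<open>The basis vector \<open>f\<^bsub>ml\<^esub>\<close> of length \<open>n - 1\<close>; only meaningful for \<open>m \<noteq> l\<close>.\<close>

definition f_vec :: "nat \<Rightarrow> nat \<Rightarrow> nat \<Rightarrow> real vec" where
  "f_vec n m l = (if m < l then unit_vec (n - 1) m else unit_vec (n - 1) (m - 1))"

text \<open>
  \<open>((I - P)(k|k))\<^sup>-\<^sup>1\<close>. The function \<^const>\<open>mat_inverse\<close> returns \<^const>\<open>None\<close> on singular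
  matrices, so \<open>the\<close> is only meaningful once invertibility is known.
\<close>

definition del_inverse :: "real mat \<Rightarrow> nat \<Rightarrow> real mat" where
  "del_inverse P k = the (mat_inverse (mat_delete (1\<^sub>m (dim_row P) - P) k k))"

end

theory Submission
  imports Defs
begin

text \<open>
  Let \<open>G = (I - P)\<^sup>-\<^sup>1\<close>, which exists because \<open>1\<close> is not an eigenvalue of \<open>P\<close>. The
  \<open>k\<close>th column \<open>g\<close> of \<open>G\<close> solves \<open>(I - P) g = e\<^sub>k\<close>. Divided by \<open>G\<^sub>k\<^sub>k\<close> and stripped of its
  \<open>k\<close>th entry, it solves the system \<open>(I - P)(k|k) y = p\<^sub>\<cdot>\<^sub>k\<close> given by the rows other than \<open>k\<close>
  (\<open>del_inverse_col_del\<close>);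
  row \<open>k\<close> then says that the denominator belonging to \<open>k\<close> in the theorem (a Schur complement)
  is \<open>1 / G\<^sub>k\<^sub>k\<close> (\<open>schur_complement_eq_inverse_diag\<close>). Hence every quotient in the theorem whose numerator contains
  \<open>f\<^sub>l\<^sub>k ((I - P)(k|k))\<^sup>-\<^sup>1 p\<^sub>\<cdot>\<^sub>k\<close> is a multiple of the single entry \<open>G\<^sub>l\<^sub>k\<close>. The numerator on the left
  of the first identity is \<open>1 - p\<^sub>m\<^sub>m - 1 / G\<^sub>m\<^sub>m\<close>, so that quotient is \<open>(1 - p\<^sub>m\<^sub>m) G\<^sub>m\<^sub>m - 1\<close>. Both
  identities thus become entries of the matrix equation \<open>G = I + G P\<close>.

  All of this requires \<open>G\<^sub>k\<^sub>k \<noteq> 0\<close>, which by Cramer's rule is also what makes \<open>(I - P)(k|k)\<close>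
  invertible. Nonnegativity enters here: \<open>G\<close> is the sum of the powers of \<open>P\<close>, whose diagonal
  entries are nonnegative, and \<open>P\<^sup>0 = I\<close> already contributes \<open>1\<close>. So \<open>G\<^sub>k\<^sub>k \<ge> 1\<close>
  (\<open>one_le_diag_inverse\<close>).
\<close>

section \<open>Diagonal entries of the inverse of \<open>I - P\<close>\<close>

lemma det_one_minus_nonzero:
  fixes P :: "real mat"
  assumes P: "P \<in> carrier_mat n n" and n: "0 < n"
    and sr: "spectral_radius (map_mat complex_of_real P) < 1"
  shows "det (1\<^sub>m n - P) \<noteq> 0"
proof
  assume "det (1\<^sub>m n - P) = 0"
  let ?C = "map_mat complex_of_real P"
  have C: "?C \<in> carrier_mat n n" using P by simp
  have "char_matrix ?C 1 = map_mat complex_of_real ((-1) \<cdot>\<^sub>m (1\<^sub>m n - P))"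
    unfolding char_matrix_def by (rule eq_matI) (use P in auto)
  then have "det (char_matrix ?C 1) = complex_of_real (det ((-1) \<cdot>\<^sub>m (1\<^sub>m n - P)))"
    by simp
  also have "\<dots> = 0" using \<open>det (1\<^sub>m n - P) = 0\<close> by (simp del: of_real_hom.hom_det)
  finally have "1 \<in> spectrum ?C"
    unfolding spectrum_def using eigenvalue_det[OF C] by simp
  then have "norm (1 :: complex) \<le> spectral_radius ?C"
    by (intro spectral_radius_mem_max(2)[OF C n] imageI)
  then show False using sr by simp
qed

lemma mult_mat_entry:
  assumes "A \<in> carrier_mat nr n" "B \<in> carrier_mat n nc" "i < nr" "j < nc"
  shows "(A * B) $$ (i, j) = (\<Sum>l = 0..<n. A $$ (i, l) * B $$ (l, j))"
  using assms by (simp add: scalar_prod_def)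

lemma mult_mat_vec_entry:
  assumes "A \<in> carrier_mat nr n" "v \<in> carrier_vec n" "i < nr"
  shows "(A *\<^sub>v v) $ i = (\<Sum>l = 0..<n. A $$ (i, l) * v $ l)"
  using assms by (simp add: scalar_prod_def)

lemma pow_mat_nonneg:
  fixes P :: "real mat"
  assumes P: "P \<in> carrier_mat n n"
    and nonneg: "\<And>i j. i < n \<Longrightarrow> j < n \<Longrightarrow> 0 \<le> P $$ (i, j)"
    and "i < n" "j < n"
  shows "0 \<le> (P ^\<^sub>m k) $$ (i, j)"
  using \<open>i < n\<close> \<open>j < n\<close>
proof (induction k arbitrary: i j)
  case 0
  then show ?case using P by simp
next
  case (Suc k)
  have "(P ^\<^sub>m Suc k) $$ (i, j) = (\<Sum>l = 0..<n. (P ^\<^sub>m k) $$ (i, l) * P $$ (l, j))"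
    using mult_mat_entry[OF pow_carrier_mat[OF P] P Suc.prems] by simp
  also have "\<dots> \<ge> 0" using Suc nonneg by (intro sum_nonneg mult_nonneg_nonneg) auto
  finally show ?case .
qed

text \<open>
  Multiplying \<open>G (I - P) = I\<close> by \<open>P\<^sup>k\<close> gives \<open>P\<^sup>k = G P\<^sup>k - G P\<^sup>k\<^sup>+\<^sup>1\<close>, so the truncated
  Neumann series telescopes and its remainder is \<open>G P\<^sup>N\<close>.
\<close>

lemma neumann_partial_sum:
  fixes P :: "'a :: comm_ring_1 mat"
  assumes P: "P \<in> carrier_mat n n" and G: "G \<in> carrier_mat n n"
    and GA: "G * (1\<^sub>m n - P) = 1\<^sub>m n" and ij: "i < n" "j < n"
  shows "(\<Sum>k<N. (P ^\<^sub>m k) $$ (i, j)) = G $$ (i, j) - (\<Sum>l = 0..<n. G $$ (i, l) * (P ^\<^sub>m N) $$ (l, j))"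
proof -
  have entry: "(G * P ^\<^sub>m k) $$ (i, j) = (\<Sum>l = 0..<n. G $$ (i, l) * (P ^\<^sub>m k) $$ (l, j))" for k
    by (rule mult_mat_entry[OF G pow_carrier_mat[OF P] ij])
  have step: "(P ^\<^sub>m k) $$ (i, j) = (G * P ^\<^sub>m k) $$ (i, j) - (G * P ^\<^sub>m Suc k) $$ (i, j)" for k
  proof -
    have Pk: "P ^\<^sub>m k \<in> carrier_mat n n" using P by simp
    have comm: "P ^\<^sub>m Suc k = P * P ^\<^sub>m k"
    proof (induction k)
      case 0
      show ?case using P by simp
    next
      case (Suc k)
      show ?case
        using Suc assoc_mult_mat[OF P pow_carrier_mat[OF P, of k] P] by simp
    qed
    have "P ^\<^sub>m k = (G * (1\<^sub>m n - P)) * P ^\<^sub>m k" unfolding GA by (rule left_mult_one_mat[OF Pk, symmetric])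
    also have "\<dots> = G * ((1\<^sub>m n - P) * P ^\<^sub>m k)"
      by (rule assoc_mult_mat) (use G P Pk in auto)
    also have "(1\<^sub>m n - P) * P ^\<^sub>m k = P ^\<^sub>m k - P ^\<^sub>m Suc k"
      unfolding comm minus_mult_distrib_mat[OF one_carrier_mat P Pk] left_mult_one_mat[OF Pk] ..
    also have "G * (P ^\<^sub>m k - P ^\<^sub>m Suc k) = G * P ^\<^sub>m k - G * P ^\<^sub>m Suc k"
      by (rule mult_minus_distrib_mat[OF G Pk pow_carrier_mat[OF P]])
    finally have "(P ^\<^sub>m k) $$ (i, j) = (G * P ^\<^sub>m k - G * P ^\<^sub>m Suc k) $$ (i, j)"
      by (rule arg_cong)
    also have "\<dots> = (G * P ^\<^sub>m k) $$ (i, j) - (G * P ^\<^sub>m Suc k) $$ (i, j)"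
      by (rule index_minus_mat) (use ij G P in auto)
    finally show ?thesis .
  qed
  have "(\<Sum>k<N. (P ^\<^sub>m k) $$ (i, j)) = (G * P ^\<^sub>m 0) $$ (i, j) - (G * P ^\<^sub>m N) $$ (i, j)"
    unfolding step by (rule sum_lessThan_telescope')
  also have "G * P ^\<^sub>m 0 = G" using G P by simp
  finally show ?thesis unfolding entry .
qed

text \<open>
  The powers of \<open>P\<close> are bounded, hence by the remainder formula so are the partial sums of the
  Neumann series. Bounded sums of nonnegative terms converge, so in fact \<open>P\<^sup>N\<close> tends to \<open>0\<close>, the
  remainder vanishes, and the series converges to \<open>G\<close>.
\<close>

lemma neumann_series_sums:
  fixes P :: "real mat"
  assumes P: "P \<in> carrier_mat n n"
    and nonneg: "\<And>i j. i < n \<Longrightarrow> j < n \<Longrightarrow> 0 \<le> P $$ (i, j)"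
    and sr: "spectral_radius (map_mat complex_of_real P) < 1"
    and G: "G \<in> carrier_mat n n" and GA: "G * (1\<^sub>m n - P) = 1\<^sub>m n"
    and ij: "i < n" "j < n"
  shows "(\<lambda>k. (P ^\<^sub>m k) $$ (i, j)) sums G $$ (i, j)"
proof -
  obtain c where c: "\<And>k. norm_bound (map_mat complex_of_real P ^\<^sub>m k) c"
    using spectral_radius_jnf_norm_bound_less_1_upper_triangular[OF _ sr] P by auto
  have bound: "\<bar>(P ^\<^sub>m k) $$ (a, b)\<bar> \<le> c" if "a < n" "b < n" for k a b
  proof -
    have "norm_bound (map_mat complex_of_real (P ^\<^sub>m k)) c"
      using c of_real_hom.mat_hom_pow[OF P] by metis
    then show ?thesis
      using that pow_carrier_mat[OF P, of k] unfolding norm_bound_def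
      by (metis carrier_matD index_map_mat norm_of_real)
  qed
  have summable: "summable (\<lambda>k. (P ^\<^sub>m k) $$ (a, b))" if ab: "a < n" "b < n" for a b
  proof (rule bounded_imp_summable)
    show "0 \<le> (P ^\<^sub>m k) $$ (a, b)" for k
      using P nonneg ab by (rule pow_mat_nonneg)
    have remainder: "\<bar>\<Sum>l = 0..<n. G $$ (a, l) * (P ^\<^sub>m Suc N) $$ (l, b)\<bar> \<le> (\<Sum>l = 0..<n. \<bar>G $$ (a, l)\<bar> * c)" for N
      by (rule order_trans[OF sum_abs], rule sum_mono)
         (use bound[of _ b "Suc N"] ab in \<open>auto simp only: abs_mult atLeastLessThan_iff intro!: mult_left_mono\<close>)
    show "(\<Sum>k\<le>N. (P ^\<^sub>m k) $$ (a, b)) \<le> \<bar>G $$ (a, b)\<bar> + (\<Sum>l = 0..<n. \<bar>G $$ (a, l)\<bar> * c)" for N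
      using neumann_partial_sum[OF P G GA ab, of "Suc N"] remainder[of N]
      unfolding lessThan_Suc_atMost by linarith
  qed
  have "(\<lambda>N. G $$ (i, j) - (\<Sum>l = 0..<n. G $$ (i, l) * (P ^\<^sub>m N) $$ (l, j)))
      \<longlonglongrightarrow> G $$ (i, j) - (\<Sum>l = 0..<n. G $$ (i, l) * 0)"
    by (intro tendsto_intros summable_LIMSEQ_zero summable) (use ij in auto)
  then show ?thesis
    unfolding sums_def neumann_partial_sum[OF P G GA ij] by simp
qed

lemma one_le_diag_inverse:
  fixes P :: "real mat"
  assumes P: "P \<in> carrier_mat n n"
    and nonneg: "\<And>i j. i < n \<Longrightarrow> j < n \<Longrightarrow> 0 \<le> P $$ (i, j)"
    and sr: "spectral_radius (map_mat complex_of_real P) < 1"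
    and G: "G \<in> carrier_mat n n" and GA: "G * (1\<^sub>m n - P) = 1\<^sub>m n"
    and k: "k < n"
  shows "1 \<le> G $$ (k, k)"
proof -
  have "(\<lambda>N. (P ^\<^sub>m N) $$ (k, k)) sums G $$ (k, k)"
    using assms by (intro neumann_series_sums)
  then have "(\<Sum>N<1. (P ^\<^sub>m N) $$ (k, k)) \<le> G $$ (k, k)"
    using pow_mat_nonneg[OF P nonneg k k]
    by (metis sums_summable sums_unique sum_le_suminf finite_lessThan)
  then show ?thesis using k P by simp
qed

section \<open>Deleting an index\<close>

lemma sum_insert_index:
  fixes f :: "nat \<Rightarrow> 'a :: comm_monoid_add"
  assumes "k < n"
  shows "(\<Sum>i = 0..<n - 1. f (insert_index k i)) = (\<Sum>i \<in> {0..<n} - {k}. f i)"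
proof -
  have "insert_index k ` {0..<n - 1} = {0..<n} - {k}"
    using insert_index_image[of k "n - 1"] assms by simp
  then show ?thesis
    using sum.reindex[OF insert_index_inj_on[of k "{0..<n - 1}"], of f] by simp
qed

lemma insert_index_less: "k < n \<Longrightarrow> i < n - 1 \<Longrightarrow> insert_index k i < n"
  unfolding insert_index_def by auto

lemma vec_del_index: "i < dim_vec v - 1 \<Longrightarrow> vec_del v k $ i = v $ insert_index k i"
  unfolding vec_del_def insert_index_def by simp

lemma dim_vec_del: "dim_vec (vec_del v k) = dim_vec v - 1"
  unfolding vec_del_def by simp

lemma f_vec_scalar_prod:
  assumes "l < n" "k < n" "l \<noteq> k" "dim_vec v = n"
  shows "f_vec n l k \<bullet> vec_del v k = v $ l"
proof -
  let ?i = "delete_index k l"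
  have "f_vec n l k = unit_vec (n - 1) ?i"
    unfolding f_vec_def delete_index_def by auto
  moreover have i: "?i < n - 1"
    unfolding delete_index_def using assms by auto
  moreover have "vec_del v k \<in> carrier_vec (n - 1)"
    by (rule carrier_vecI) (simp only: dim_vec_del assms(4))
  ultimately have "f_vec n l k \<bullet> vec_del v k = vec_del v k $ ?i"
    by simp
  also have "\<dots> = v $ l"
    using vec_del_index[of ?i v k] i assms(3,4) by (simp only: insert_delete_index[OF assms(3)])
  finally show ?thesis .
qed

section \<open>Deleted minors in terms of the full inverse\<close>

text \<open>
  Cramer's rule for one diagonal entry; it reduces the invertibility of \<open>(I - P)(k|k)\<close> to
  \<open>G\<^sub>k\<^sub>k \<noteq> 0\<close>.
\<close>

lemma det_mat_delete_diag:
  fixes A G :: "'a :: comm_ring_1 mat"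
  assumes A: "A \<in> carrier_mat n n" and G: "G \<in> carrier_mat n n"
    and GA: "G * A = 1\<^sub>m n" and k: "k < n"
  shows "det (mat_delete A k k) = det A * G $$ (k, k)"
proof -
  note adj = adj_mat[OF A]
  have "adj_mat A = (G * A) * adj_mat A" using GA adj(1) by simp
  also have "\<dots> = G * (A * adj_mat A)" by (rule assoc_mult_mat[OF G A adj(1)])
  also have "\<dots> = det A \<cdot>\<^sub>m G" unfolding adj(2) using mult_smult_distrib[OF G one_carrier_mat] G by simp
  finally have "adj_mat A $$ (k, k) = det A * G $$ (k, k)" using G k by simp
  then show ?thesis using A k by (simp add: adj_mat_def cofactor_def)
qed

lemma nonzero_det_mat_inverse:
  fixes A :: "'a :: field mat"
  assumes A: "A \<in> carrier_mat n n" and d: "det A \<noteq> 0"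
  obtains B where "mat_inverse A = Some B" "A * B = 1\<^sub>m n" "B * A = 1\<^sub>m n" "B \<in> carrier_mat n n"
  using mat_inverse(1)[OF A, where b = "()"] mat_inverse(2)[OF A]
    det_non_zero_imp_unit[OF A d, where b = "()"]
  by (cases "mat_inverse A") auto

text \<open>
  The rows of \<open>(I - P) g = e\<^sub>k\<close> other than the \<open>k\<close>th, read as a linear system for the entries of
  \<open>g\<close> other than the \<open>k\<close>th.
\<close>

lemma del_inverse_col_del:
  fixes P :: "real mat"
  assumes P: "P \<in> carrier_mat n n" and G: "G \<in> carrier_mat n n"
    and AG: "(1\<^sub>m n - P) * G = 1\<^sub>m n"
    and det: "det (mat_delete (1\<^sub>m n - P) k k) \<noteq> 0"
    and Gk: "G $$ (k, k) \<noteq> 0" and k: "k < n"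
  shows "del_inverse P k *\<^sub>v col_del P k = vec_del ((1 / G $$ (k, k)) \<cdot>\<^sub>v col G k) k"
proof -
  let ?A = "1\<^sub>m n - P" and ?g = "(1 / G $$ (k, k)) \<cdot>\<^sub>v col G k"
  let ?B = "mat_delete ?A k k" and ?w = "vec_del ?g k"
  have A: "?A \<in> carrier_mat n n" using P by (rule minus_carrier_mat)
  have B: "?B \<in> carrier_mat (n - 1) (n - 1)" by (rule mat_delete_carrier[OF A])
  have w: "?w \<in> carrier_vec (n - 1)" using G by (simp add: carrier_vecI dim_vec_del)
  obtain C where C: "mat_inverse ?B = Some C" "C * ?B = 1\<^sub>m (n - 1)"
      "C \<in> carrier_mat (n - 1) (n - 1)"
    using nonzero_det_mat_inverse[OF B det] by metis
  have "?B *\<^sub>v ?w = col_del P k"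
  proof (rule eq_vecI)
    fix i assume "i < dim_vec (col_del P k)"
    then have i: "i < n - 1" using P by (simp add: col_del_def dim_vec_del)
    let ?a = "insert_index k i"
    have a: "?a < n" "?a \<noteq> k" using i k by (auto simp: insert_index_less)
    have B_entry: "?B $$ (i, j) = ?A $$ (?a, insert_index k j)" if "j < n - 1" for j
      using that i k A P unfolding mat_delete_def insert_index_def by auto
    have w_entry: "?w $ j = G $$ (insert_index k j, k) / G $$ (k, k)" if "j < n - 1" for j
      using that G k insert_index_less[OF k that] by (simp add: vec_del_index)
    have "(?B *\<^sub>v ?w) $ i = (\<Sum>j = 0..<n - 1. ?B $$ (i, j) * ?w $ j)"
      by (rule mult_mat_vec_entry[OF B w i])
    also have "\<dots> = (\<Sum>j = 0..<n - 1. ?A $$ (?a, insert_index k j) * G $$ (insert_index k j, k) / G $$ (k, k))"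
      by (rule sum.cong) (simp_all add: B_entry w_entry del: index_minus_mat)
    also have "\<dots> = (\<Sum>j \<in> {0..<n} - {k}. ?A $$ (?a, j) * G $$ (j, k) / G $$ (k, k))"
      by (rule sum_insert_index[OF k, of "\<lambda>j. ?A $$ (?a, j) * G $$ (j, k) / G $$ (k, k)"])
    also have "\<dots> = (\<Sum>j = 0..<n. ?A $$ (?a, j) * G $$ (j, k)) / G $$ (k, k) - ?A $$ (?a, k)"
      using k Gk by (simp add: sum_diff1 sum_divide_distrib del: index_minus_mat)
    also have "(\<Sum>j = 0..<n. ?A $$ (?a, j) * G $$ (j, k)) = (?A * G) $$ (?a, k)"
      using mult_mat_entry[OF A G a(1) k] by simp
    also have "\<dots> = 0" using AG a k by simp
    also have "0 / G $$ (k, k) - ?A $$ (?a, k) = P $$ (?a, k)" using a k P by simp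
    also have "\<dots> = col_del P k $ i"
      using i a k P by (simp add: col_del_def vec_del_index)
    finally show "(?B *\<^sub>v ?w) $ i = col_del P k $ i" .
  qed (use B P in \<open>simp add: col_del_def dim_vec_del\<close>)
  then have "del_inverse P k *\<^sub>v col_del P k = C *\<^sub>v (?B *\<^sub>v ?w)"
    using C(1) P by (simp add: del_inverse_def)
  also have "\<dots> = (C * ?B) *\<^sub>v ?w" using assoc_mult_mat_vec[OF C(3) B w] by simp
  also have "\<dots> = ?w" using C(2) w by simp
  finally show ?thesis .
qed

text \<open>The remaining row, the \<open>k\<close>th, of the same equation.\<close>

lemma schur_complement_eq_inverse_diag:
  fixes P :: "real mat"
  assumes P: "P \<in> carrier_mat n n" and G: "G \<in> carrier_mat n n"
    and AG: "(1\<^sub>m n - P) * G = 1\<^sub>m n"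
    and Gk: "G $$ (k, k) \<noteq> 0" and k: "k < n"
  shows "1 - P $$ (k, k) - row_del P k \<bullet> vec_del ((1 / G $$ (k, k)) \<cdot>\<^sub>v col G k) k = 1 / G $$ (k, k)"
proof -
  let ?A = "1\<^sub>m n - P" and ?w = "vec_del ((1 / G $$ (k, k)) \<cdot>\<^sub>v col G k) k"
  have A: "?A \<in> carrier_mat n n" using P by (rule minus_carrier_mat)
  have "row_del P k \<bullet> ?w
      = (\<Sum>j = 0..<n - 1. P $$ (k, insert_index k j) * G $$ (insert_index k j, k) / G $$ (k, k))"
    using P G k by (simp add: scalar_prod_def row_del_def dim_vec_del vec_del_index insert_index_less)
  also have "\<dots> = (\<Sum>j \<in> {0..<n} - {k}. P $$ (k, j) * G $$ (j, k) / G $$ (k, k))"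
    by (rule sum_insert_index[OF k, of "\<lambda>j. P $$ (k, j) * G $$ (j, k) / G $$ (k, k)"])
  also have "\<dots> = - (\<Sum>j \<in> {0..<n} - {k}. ?A $$ (k, j) * G $$ (j, k) / G $$ (k, k))"
    unfolding sum_negf[symmetric] by (rule sum.cong) (use k P in auto)
  also have "(\<Sum>j \<in> {0..<n} - {k}. ?A $$ (k, j) * G $$ (j, k) / G $$ (k, k))
      = (\<Sum>j = 0..<n. ?A $$ (k, j) * G $$ (j, k)) / G $$ (k, k) - ?A $$ (k, k)"
    using k Gk by (simp add: sum_diff1 sum_divide_distrib del: index_minus_mat)
  also have "(\<Sum>j = 0..<n. ?A $$ (k, j) * G $$ (j, k)) = (?A * G) $$ (k, k)"
    using mult_mat_entry[OF A G k k] by simp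
  also have "\<dots> = 1" using AG k by simp
  finally show ?thesis using k P by simp
qed

text \<open>
  For \<open>i = j\<close> and for \<open>i \<noteq> j\<close> this is what the two identities of the theorem amount to, once
  their quotients have been replaced by entries of \<open>G\<close>.
\<close>

lemma inverse_one_minus_entry:
  fixes P :: "'a :: comm_ring_1 mat"
  assumes P: "P \<in> carrier_mat n n" and G: "G \<in> carrier_mat n n"
    and GA: "G * (1\<^sub>m n - P) = 1\<^sub>m n" and ij: "i < n" "j < n"
  shows "G $$ (i, j) = (if i = j then 1 else 0) + (\<Sum>k = 0..<n. P $$ (k, j) * G $$ (i, k))"
proof -
  have "(if i = j then 1 else 0) = (G * (1\<^sub>m n - P)) $$ (i, j)"
    using GA ij by simp
  also have "G * (1\<^sub>m n - P) = G - G * P"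
    using mult_minus_distrib_mat[OF G one_carrier_mat P] G by simp
  also have "\<dots> $$ (i, j) = G $$ (i, j) - (\<Sum>k = 0..<n. P $$ (k, j) * G $$ (i, k))"
    using mult_mat_entry[OF G P ij] G P ij by (simp add: mult.commute)
  finally show ?thesis by simp
qed

section \<open>The identities\<close>

theorem theorem2:
  fixes n :: nat and P :: "real mat"
  assumes "2 \<le> n"
    and "P \<in> carrier_mat n n"
    and "row_substochastic P"
    and "spectral_radius (map_mat complex_of_real P) < 1"
  shows
    "(\<forall>k<n. invertible_mat (mat_delete (1\<^sub>m n - P) k k) \<and>
        1 - P $$ (k, k) - row_del P k \<bullet> (del_inverse P k *\<^sub>v col_del P k) \<noteq> 0) \<and>
     (\<forall>m<n.
        (row_del P m \<bullet> (del_inverse P m *\<^sub>v col_del P m)) /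
          (1 - P $$ (m, m) - row_del P m \<bullet> (del_inverse P m *\<^sub>v col_del P m))
        = (\<Sum>k \<in> {0..<n} - {m}.
            (P $$ (k, m) * (f_vec n m k \<bullet> (del_inverse P k *\<^sub>v col_del P k))) /
              (1 - P $$ (k, k) - row_del P k \<bullet> (del_inverse P k *\<^sub>v col_del P k)))) \<and>
     (\<forall>l<n. \<forall>m<n. l \<noteq> m \<longrightarrow>
        ((1 - P $$ (m, m)) * (f_vec n l m \<bullet> (del_inverse P m *\<^sub>v col_del P m))) /
          (1 - P $$ (m, m) - row_del P m \<bullet> (del_inverse P m *\<^sub>v col_del P m))
        = P $$ (l, m) /
            (1 - P $$ (l, l) - row_del P l \<bullet> (del_inverse P l *\<^sub>v col_del P l))
          + (\<Sum>k \<in> {0..<n} - {l, m}.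
              (P $$ (k, m) * (f_vec n l k \<bullet> (del_inverse P k *\<^sub>v col_del P k))) /
                (1 - P $$ (k, k) - row_del P k \<bullet> (del_inverse P k *\<^sub>v col_del P k))))"
proof -
  note n = assms(1) and P = assms(2) and sr = assms(4)
  let ?A = "1\<^sub>m n - P"
  let ?y = "\<lambda>k. del_inverse P k *\<^sub>v col_del P k"
  have nonneg: "0 \<le> P $$ (i, j)" if "i < n" "j < n" for i j
    using assms(3) that P unfolding row_substochastic_def by auto
  have A: "?A \<in> carrier_mat n n" using P by (rule minus_carrier_mat)
  have detA: "det ?A \<noteq> 0" using det_one_minus_nonzero[OF P _ sr] n by simp
  obtain G where AG: "?A * G = 1\<^sub>m n" and GA: "G * ?A = 1\<^sub>m n" and G: "G \<in> carrier_mat n n"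
    using nonzero_det_mat_inverse[OF A detA] by metis
  have Gk: "G $$ (k, k) \<noteq> 0" if "k < n" for k
    using one_le_diag_inverse[OF P nonneg sr G GA that] by simp
  have det_minor: "det (mat_delete ?A k k) \<noteq> 0" if "k < n" for k
    using det_mat_delete_diag[OF A G GA that] detA Gk[OF that] by simp
  have y: "?y k = vec_del ((1 / G $$ (k, k)) \<cdot>\<^sub>v col G k) k" if "k < n" for k
    by (rule del_inverse_col_del[OF P G AG det_minor[OF that] Gk[OF that] that])
  have schur: "1 - P $$ (k, k) - row_del P k \<bullet> ?y k = 1 / G $$ (k, k)" if "k < n" for k
    unfolding y[OF that] by (rule schur_complement_eq_inverse_diag[OF P G AG Gk[OF that] that])
  have f_entry: "f_vec n l k \<bullet> ?y k = G $$ (l, k) / G $$ (k, k)"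
    if "l < n" "k < n" "l \<noteq> k" for l k
    unfolding y[OF that(2)] using f_vec_scalar_prod[OF that] that G by simp
  have summand: "(P $$ (k, m) * (f_vec n l k \<bullet> ?y k)) / (1 - P $$ (k, k) - row_del P k \<bullet> ?y k)
      = P $$ (k, m) * G $$ (l, k)" if "l < n" "k < n" "l \<noteq> k" for l k m
    unfolding schur[OF that(2)] f_entry[OF that] using Gk[OF that(2)] by simp
  have 1: "invertible_mat (mat_delete ?A k k) \<and> 1 - P $$ (k, k) - row_del P k \<bullet> ?y k \<noteq> 0"
    if k: "k < n" for k
  proof
    have B: "mat_delete ?A k k \<in> carrier_mat (n - 1) (n - 1)" by (rule mat_delete_carrier[OF A])
    show "invertible_mat (mat_delete ?A k k)"
      using nonzero_det_mat_inverse[OF B det_minor[OF k]] B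
      unfolding invertible_mat_def inverts_mat_def square_mat.simps by (metis carrier_matD)
    show "1 - P $$ (k, k) - row_del P k \<bullet> ?y k \<noteq> 0"
      unfolding schur[OF k] using Gk[OF k] by simp
  qed
  have 2: "(row_del P m \<bullet> ?y m) / (1 - P $$ (m, m) - row_del P m \<bullet> ?y m)
      = (\<Sum>k \<in> {0..<n} - {m}.
          (P $$ (k, m) * (f_vec n m k \<bullet> ?y k)) / (1 - P $$ (k, k) - row_del P k \<bullet> ?y k))"
    if m: "m < n" for m
  proof -
    have "row_del P m \<bullet> ?y m = 1 - P $$ (m, m) - 1 / G $$ (m, m)" using schur[OF m] by simp
    then have "(row_del P m \<bullet> ?y m) / (1 - P $$ (m, m) - row_del P m \<bullet> ?y m)
        = (1 - P $$ (m, m) - 1 / G $$ (m, m)) / (1 / G $$ (m, m))"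
      by simp
    also have "\<dots> = (G $$ (m, m) - 1) - P $$ (m, m) * G $$ (m, m)"
      using Gk[OF m] by (simp add: field_simps)
    also have "\<dots> = (\<Sum>k = 0..<n. P $$ (k, m) * G $$ (m, k)) - P $$ (m, m) * G $$ (m, m)"
      using inverse_one_minus_entry[OF P G GA m m] by simp
    also have "\<dots> = (\<Sum>k \<in> {0..<n} - {m}. P $$ (k, m) * G $$ (m, k))"
      using m by (simp add: sum_diff1)
    also have "\<dots> = (\<Sum>k \<in> {0..<n} - {m}.
        (P $$ (k, m) * (f_vec n m k \<bullet> ?y k)) / (1 - P $$ (k, k) - row_del P k \<bullet> ?y k))"
      by (rule sum.cong) (use m in \<open>auto simp: summand\<close>)
    finally show ?thesis .
  qed
  have 3: "((1 - P $$ (m, m)) * (f_vec n l m \<bullet> ?y m)) / (1 - P $$ (m, m) - row_del P m \<bullet> ?y m)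
      = P $$ (l, m) / (1 - P $$ (l, l) - row_del P l \<bullet> ?y l)
        + (\<Sum>k \<in> {0..<n} - {l, m}.
            (P $$ (k, m) * (f_vec n l k \<bullet> ?y k)) / (1 - P $$ (k, k) - row_del P k \<bullet> ?y k))"
    if l: "l < n" and m: "m < n" and lm: "l \<noteq> m" for l m
  proof -
    have "((1 - P $$ (m, m)) * (f_vec n l m \<bullet> ?y m)) / (1 - P $$ (m, m) - row_del P m \<bullet> ?y m)
        = G $$ (l, m) - P $$ (m, m) * G $$ (l, m)"
      unfolding schur[OF m] f_entry[OF l m lm] using Gk[OF m] by (simp add: field_simps)
    also have "\<dots> = (\<Sum>k = 0..<n. P $$ (k, m) * G $$ (l, k)) - P $$ (m, m) * G $$ (l, m)"
      using inverse_one_minus_entry[OF P G GA l m] lm by simp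
    also have "\<dots> = P $$ (l, m) * G $$ (l, l) + (\<Sum>k \<in> {0..<n} - {l, m}. P $$ (k, m) * G $$ (l, k))"
      using sum.remove[of "{0..<n}" l "\<lambda>k. P $$ (k, m) * G $$ (l, k)"]
        sum.remove[of "{0..<n} - {l}" m "\<lambda>k. P $$ (k, m) * G $$ (l, k)"] l m lm
      unfolding Diff_insert2[of _ l "{m}"] by simp
    also have "(\<Sum>k \<in> {0..<n} - {l, m}. P $$ (k, m) * G $$ (l, k)) = (\<Sum>k \<in> {0..<n} - {l, m}.
        (P $$ (k, m) * (f_vec n l k \<bullet> ?y k)) / (1 - P $$ (k, k) - row_del P k \<bullet> ?y k))"
      by (rule sum.cong) (use l in \<open>simp_all add: summand\<close>)
    also have "P $$ (l, m) * G $$ (l, l) = P $$ (l, m) / (1 - P $$ (l, l) - row_del P l \<bullet> ?y l)"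
      unfolding schur[OF l] by simp
    finally show ?thesis .
  qed
  show ?thesis using 1 2 3 by blast
qed

end
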